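(* Let $A\in\mathcal{M}_n(\mathbb{C})$ and let $B\in\mathcal{M}_m(\mathbb{C})$ be a circulant matrix with first row $(b_0,b_1,\ldots,b_{m-1})$, $b_i\in\mathbb{C}$. Let $\rho=\exp\left(\frac{2\pi i}{m}\right)$ (where in this exponent $i=\sqrt{-1}$). Then the spectrum of $A\wr B$ is the union, over all $(i_1,\ldots,i_n)\in\{0,1,\ldots,m-1\}^n$, of the spectra of the $m^n$ matrices of order $n$ given by $$\widetilde{M}^{i_1,i_2,\ldots,i_n}=A+\sum_{t=1}^n\sum_{i=0}^{m-1}b_i\rho^{i\,i_t}C_t .$$
   Context: $n,m$ are positive integers. Wreath product of matrices: for $A\in\mathcal{M}_n(\mathbb{C})$ and $B\in\mathcal{M}_m(\mathbb{C})$, $$A\wr B = I_m^{\otimes n}\otimes A+\sum_{i=1}^n I_m^{\otimes (i-1)}\otimes B\otimes I_m^{\otimes (n-i)}\otimes C_i,$$ a square matrix of order $nm^n$. Here $\otimes$ is the Kronecker product, $I_m^{\otimes r}$ is the $r$-fold Kronecker power, with $I_m^{\otimes 0}=1$, and $C_i\in\mathcal{M}_n(\mathbb{C})$ has entry $1$ in position $(i,i)$ and $0$ elsewhere. A circulant matrix with first row $(b_0,\ldots,b_{m-1})$ is the matrix whose $(h,k)$ entry is $b_{(k-h)\bmod m}$. Spectra are multisets of eigenvalues counted with algebraic multiplicity, and the union is a union of multisets with multiplicities added (so the characteristic polynomial of $A\wr B$ is the product of those of the matrices $\widetilde{M}^{i_1,\ldots,i_n}$). *)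

theory Defs
  imports "Jordan_Normal_Form.Spectral_Radius"
begin

text \<open>
  Rows and columns of type \<^typ>\<open>'a mat\<close> are numbered from 0. The indices \<open>i\<close> and \<open>t\<close> of the
  tensor factors and of the matrices \<open>C\<^sub>i\<close> run from 1 to \<open>n\<close>.
\<close>

definition kron :: "'a :: semiring_1 mat \<Rightarrow> 'a mat \<Rightarrow> 'a mat" (infixl \<open>\<otimes>\<^sub>K\<close> 70) where
  "A \<otimes>\<^sub>K B = mat (dim_row A * dim_row B) (dim_col A * dim_col B)
     (\<lambda>(i, j). A $$ (i div dim_row B, j div dim_col B) * B $$ (i mod dim_row B, j mod dim_col B))"

fun kron_pow :: "'a :: semiring_1 mat \<Rightarrow> nat \<Rightarrow> 'a mat" where
  "kron_pow A 0 = 1\<^sub>m 1"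
| "kron_pow A (Suc r) = A \<otimes>\<^sub>K kron_pow A r"

text \<open>
  The library has no zero matrix independent of the dimension, so the big sum is not available
  for \<^typ>\<open>'a mat\<close>; the order \<open>d\<close> of the summands is given explicitly.
\<close>

definition mat_sum :: "nat \<Rightarrow> ('i \<Rightarrow> 'a :: comm_monoid_add mat) \<Rightarrow> 'i set \<Rightarrow> 'a mat" where
  "mat_sum d f I = mat d d (\<lambda>(h, k). \<Sum>i\<in>I. f i $$ (h, k))"

definition diag_unit :: "nat \<Rightarrow> nat \<Rightarrow> 'a :: semiring_1 mat" where
  "diag_unit n i = mat n n (\<lambda>(h, k). if Suc h = i \<and> Suc k = i then 1 else 0)"

definition wreath :: "complex mat \<Rightarrow> complex mat \<Rightarrow> complex mat" (infixl \<open>\<wr>\<close> 65) where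
  "A \<wr> B = (let n = dim_row A; m = dim_row B in
     kron_pow (1\<^sub>m m) n \<otimes>\<^sub>K A +
     mat_sum (n * m ^ n)
       (\<lambda>i. kron_pow (1\<^sub>m m) (i - 1) \<otimes>\<^sub>K B \<otimes>\<^sub>K kron_pow (1\<^sub>m m) (n - i) \<otimes>\<^sub>K diag_unit n i)
       {1..n})"

definition circulant_mat :: "nat \<Rightarrow> (nat \<Rightarrow> 'a) \<Rightarrow> 'a mat" where
  "circulant_mat m b = mat m m (\<lambda>(h, k). b (nat ((int k - int h) mod int m)))"

definition spectrum_mset :: "complex mat \<Rightarrow> complex multiset" where
  "spectrum_mset M = proots (char_poly M)"

lemma set_spectrum_mset:
  assumes "M \<in> carrier_mat d d"
  shows "set_mset (spectrum_mset M) = spectrum M"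
proof -
  have "char_poly M \<noteq> 0"
    using degree_monic_char_poly[OF assms] by auto
  then show ?thesis
    using eigenvalue_root_char_poly[OF assms] by (auto simp: spectrum_mset_def spectrum_def)
qed

lemma count_spectrum_mset:
  assumes "M \<in> carrier_mat d d"
  shows "count (spectrum_mset M) z = order z (char_poly M)"
proof -
  have "char_poly M \<noteq> 0"
    using degree_monic_char_poly[OF assms] by auto
  then show ?thesis
    by (simp add: spectrum_mset_def)
qed

lemma mat_sum_insert:
  assumes "finite I" "i \<notin> I" "f i \<in> carrier_mat d d"
  shows "mat_sum d f (insert i I) = f i + mat_sum d f I"
  using assms by (intro eq_matI) (auto simp: mat_sum_def)

lemma kron_carrier:
  assumes "A \<in> carrier_mat r c" "B \<in> carrier_mat r' c'"
  shows "A \<otimes>\<^sub>K B \<in> carrier_mat (r * r') (c * c')"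
  using assms by (auto simp: kron_def)

lemma kron_pow_carrier:
  assumes "A \<in> carrier_mat r c"
  shows "kron_pow A k \<in> carrier_mat (r ^ k) (c ^ k)"
  using assms by (induction k) (auto intro: kron_carrier)

lemma wreath_summand_carrier:
  assumes "B \<in> carrier_mat m m" "i \<in> {1..n}"
  shows "kron_pow (1\<^sub>m m) (i - 1) \<otimes>\<^sub>K B \<otimes>\<^sub>K kron_pow (1\<^sub>m m) (n - i) \<otimes>\<^sub>K diag_unit n i
           \<in> carrier_mat (n * m ^ n) (n * m ^ n)"
proof -
  have "m ^ (i - 1) * m * m ^ (n - i) * n = m ^ (i - 1 + 1 + (n - i)) * n"
    by (simp add: power_add)
  also have "i - 1 + 1 + (n - i) = n"
    using assms(2) by simp
  finally have eq: "m ^ (i - 1) * m * m ^ (n - i) * n = n * m ^ n"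
    by (simp only: mult.commute[of n])
  have "diag_unit n i \<in> carrier_mat n n"
    by (simp add: diag_unit_def)
  then have "kron_pow (1\<^sub>m m) (i - 1) \<otimes>\<^sub>K B \<otimes>\<^sub>K kron_pow (1\<^sub>m m) (n - i) \<otimes>\<^sub>K diag_unit n i
      \<in> carrier_mat (m ^ (i - 1) * m * m ^ (n - i) * n) (m ^ (i - 1) * m * m ^ (n - i) * n)"
    by (intro kron_carrier kron_pow_carrier assms(1)) auto
  then show ?thesis
    by (simp only: eq)
qed

lemma wreath_carrier:
  assumes "A \<in> carrier_mat n n" "B \<in> carrier_mat m m"
  shows "A \<wr> B \<in> carrier_mat (n * m ^ n) (n * m ^ n)"
  using assms by (auto simp: wreath_def Let_def mat_sum_def)

end

theory Submission
  imports Defs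
begin

text \<open>
  The Fourier matrix \<open>F\<close> diagonalises the circulant matrix: \<open>B F = F D\<close>, where \<open>D\<close> has the diagonal
  entries \<open>d\<^sub>k = \<Sum>\<^sub>i b\<^sub>i \<rho>\<^bsup>i k\<^esup>\<close>. By the mixed product rule, conjugation by
  \<open>P = F \<otimes> \<dots> \<otimes> F \<otimes> I\<^sub>n\<close> fixes the summand \<open>I \<otimes> A\<close> and replaces \<open>B\<close> by \<open>D\<close> in the other summands, so
  \<open>A \<wr> B\<close> is similar to \<open>A \<wr> D\<close>. The latter is block diagonal: its block number \<open>r < m\<^sup>n\<close> is
  \<open>A\<close> plus the diagonal matrix with entries \<open>d\<close> evaluated at the \<open>n\<close> base-\<open>m\<close> digits of \<open>r\<close>.
\<close>

section \<open>Algebra of the Kronecker product\<close>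

text \<open>Every \<open>k < a * b\<close> is \<open>i * b + j\<close> for exactly one pair
  \<open>i < a\<close>, \<open>j < b\<close>. This factors the sum over the inner index of a product
  of two Kronecker products.\<close>

lemma sum_div_mod_nat:
  fixes f g :: "nat \<Rightarrow> 'a :: semiring_0"
  shows "(\<Sum>k<a * b. f (k div b) * g (k mod b)) = (\<Sum>i<a. f i) * (\<Sum>j<b. g j)"
proof -
  have "(\<Sum>k<a * b. f (k div b) * g (k mod b)) =
      (\<Sum>i<a. \<Sum>k\<in>{i * b..<i * b + b}. f (k div b) * g (k mod b))"
    by (rule sum.nat_group[symmetric])
  also have "\<dots> = (\<Sum>i<a. \<Sum>j<b. f i * g j)"
  proof (rule sum.cong)
    fix i
    show "(\<Sum>k\<in>{i * b..<i * b + b}. f (k div b) * g (k mod b)) = (\<Sum>j<b. f i * g j)"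
      using sum.shift_bounds_nat_ivl[of "\<lambda>k. f (k div b) * g (k mod b)" 0 "i * b" b]
      by (simp add: add.commute atLeast0LessThan)
  qed simp
  finally show ?thesis
    by (simp add: sum_product)
qed

lemma dim_kron [simp]:
  "dim_row (A \<otimes>\<^sub>K B) = dim_row A * dim_row B"
  "dim_col (A \<otimes>\<^sub>K B) = dim_col A * dim_col B"
  by (simp_all add: kron_def)

lemma index_kron:
  assumes "i < dim_row A * dim_row B" "j < dim_col A * dim_col B"
  shows "(A \<otimes>\<^sub>K B) $$ (i, j) =
    A $$ (i div dim_row B, j div dim_col B) * B $$ (i mod dim_row B, j mod dim_col B)"
  using assms by (simp add: kron_def)

lemma div_mod_less_of_less_mult:
  fixes i :: nat
  assumes "i < a * b"
  shows "i div b < a" "i mod b < b"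
  using assms by (auto simp: less_mult_imp_div_less intro!: mod_less_divisor gr0I)

text \<open>Both bracketings decode an index by the same mixed-radix expansion, with digits
  \<open>k div (b * c)\<close>, \<open>k div c mod b\<close> and \<open>k mod c\<close>. Hence the
  two matrices coincide entry by entry, without any reindexing.\<close>

lemma kron_assoc: "A \<otimes>\<^sub>K B \<otimes>\<^sub>K C = A \<otimes>\<^sub>K (B \<otimes>\<^sub>K C)"
proof (rule eq_matI)
  fix i j
  assume "i < dim_row (A \<otimes>\<^sub>K (B \<otimes>\<^sub>K C))" "j < dim_col (A \<otimes>\<^sub>K (B \<otimes>\<^sub>K C))"
  then have ij: "i < dim_row A * dim_row B * dim_row C" "j < dim_col A * dim_col B * dim_col C"
    by (simp_all add: mult.assoc)
  have split: "k mod (b * c) div c = k div c mod b" "k mod (b * c) mod c = k mod c"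
    "k div (b * c) = k div c div b" "k mod (b * c) < b * c" if "k < a * b * c" for a b c k :: nat
  proof -
    show "k mod (b * c) div c = k div c mod b"
      using that by (cases "c = 0") (simp_all add: mod_mult2_eq mult.commute[of b])
    show "k mod (b * c) mod c = k mod c"
      by (simp add: mod_mod_cancel)
    show "k div (b * c) = k div c div b"
      by (simp add: div_mult2_eq mult.commute[of b])
    show "k mod (b * c) < b * c"
      using that by (intro mod_less_divisor gr0I) auto
  qed
  from div_mod_less_of_less_mult[OF ij(1)] div_mod_less_of_less_mult[OF ij(2)] ij
  show "(A \<otimes>\<^sub>K B \<otimes>\<^sub>K C) $$ (i, j) = (A \<otimes>\<^sub>K (B \<otimes>\<^sub>K C)) $$ (i, j)"
    by (simp add: index_kron split[OF ij(1)] split[OF ij(2)] mult.assoc[symmetric])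
qed (simp_all add: mult.assoc)

text \<open>The mixed product rule: commutativity brings the entries of \<open>A\<close> next to
  those of \<open>C\<close>, and the sum over the composite inner index then splits into two
  independent sums.\<close>

lemma kron_mult:
  fixes A B C D :: "'a :: comm_semiring_1 mat"
  assumes "A \<in> carrier_mat a p" "B \<in> carrier_mat b q" "C \<in> carrier_mat p c" "D \<in> carrier_mat q d"
  shows "(A \<otimes>\<^sub>K B) * (C \<otimes>\<^sub>K D) = (A * C) \<otimes>\<^sub>K (B * D)"
proof (rule eq_matI)
  fix i j
  assume "i < dim_row ((A * C) \<otimes>\<^sub>K (B * D))" "j < dim_col ((A * C) \<otimes>\<^sub>K (B * D))"
  with assms have ij: "i < a * b" "j < c * d"
    by auto
  note bounds = div_mod_less_of_less_mult[OF ij(1)] div_mod_less_of_less_mult[OF ij(2)]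
  have "((A \<otimes>\<^sub>K B) * (C \<otimes>\<^sub>K D)) $$ (i, j) = (\<Sum>k<p * q. (A \<otimes>\<^sub>K B) $$ (i, k) * (C \<otimes>\<^sub>K D) $$ (k, j))"
    using assms ij by (auto simp: scalar_prod_def atLeast0LessThan)
  also have "\<dots> = (\<Sum>k<p * q. (A $$ (i div b, k div q) * C $$ (k div q, j div d)) *
      (B $$ (i mod b, k mod q) * D $$ (k mod q, j mod d)))"
    using assms ij by (intro sum.cong) (auto simp: index_kron mult_ac)
  also have "\<dots> = (\<Sum>k<p. A $$ (i div b, k) * C $$ (k, j div d)) *
      (\<Sum>k<q. B $$ (i mod b, k) * D $$ (k, j mod d))"
    by (rule sum_div_mod_nat)
  also have "\<dots> = ((A * C) \<otimes>\<^sub>K (B * D)) $$ (i, j)"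
    using assms ij bounds by (simp add: index_kron scalar_prod_def atLeast0LessThan)
  finally show "((A \<otimes>\<^sub>K B) * (C \<otimes>\<^sub>K D)) $$ (i, j) = ((A * C) \<otimes>\<^sub>K (B * D)) $$ (i, j)" .
qed (use assms in auto)

text \<open>A position lies on the diagonal exactly when its row and column agree in both quotient
  and remainder by \<open>b\<close>.\<close>

lemma kron_mat_diag:
  "mat_diag a f \<otimes>\<^sub>K mat_diag b g = mat_diag (a * b) (\<lambda>r. f (r div b) * g (r mod b))"
proof (rule eq_matI)
  fix i j
  assume "i < dim_row (mat_diag (a * b) (\<lambda>r. f (r div b) * g (r mod b)))"
    "j < dim_col (mat_diag (a * b) (\<lambda>r. f (r div b) * g (r mod b)))"
  then have ij: "i < a * b" "j < a * b"
    by (simp_all add: mat_diag_def)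
  have "i = j" if "i div b = j div b" "i mod b = j mod b"
    using that by (metis div_mult_mod_eq)
  then show "(mat_diag a f \<otimes>\<^sub>K mat_diag b g) $$ (i, j) =
      mat_diag (a * b) (\<lambda>r. f (r div b) * g (r mod b)) $$ (i, j)"
    using ij div_mod_less_of_less_mult[OF ij(1)] div_mod_less_of_less_mult[OF ij(2)]
    by (auto simp: mat_diag_def kron_def)
qed (simp_all add: mat_diag_def)

lemma kron_one: "1\<^sub>m a \<otimes>\<^sub>K 1\<^sub>m b = 1\<^sub>m (a * b)"
  unfolding mat_diag_one[symmetric] kron_mat_diag by simp

lemma one_kron [simp]: "1\<^sub>m 1 \<otimes>\<^sub>K A = A"
  by (rule eq_matI) (auto simp: index_kron)

lemma kron_pow_add: "kron_pow A (r + s) = kron_pow A r \<otimes>\<^sub>K kron_pow A s"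
  by (induction r) (simp_all add: kron_assoc del: One_nat_def)

lemma kron_pow_one: "kron_pow (1\<^sub>m m) r = 1\<^sub>m (m ^ r)"
  by (induction r) (simp_all add: kron_one)

lemma kron_pow_mult:
  fixes A B :: "'a :: comm_semiring_1 mat"
  assumes "A \<in> carrier_mat a p" "B \<in> carrier_mat p c"
  shows "kron_pow A r * kron_pow B r = kron_pow (A * B) r"
proof (induction r)
  case (Suc r)
  have "kron_pow A (Suc r) * kron_pow B (Suc r) = (A * B) \<otimes>\<^sub>K (kron_pow A r * kron_pow B r)"
    using kron_mult[OF assms(1) kron_pow_carrier[OF assms(1)] assms(2) kron_pow_carrier[OF assms(2)]]
    by simp
  then show ?case
    by (simp add: Suc)
qed simp

text \<open>Isolates tensor factor number \<open>i\<close>, so that a Kronecker power gets the shape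
  of the \<open>i\<close>-th summand of the wreath product and can be multiplied with it factor by
  factor.\<close>

lemma kron_pow_split:
  assumes "i \<in> {1..n}"
  shows "kron_pow A n = kron_pow A (i - 1) \<otimes>\<^sub>K A \<otimes>\<^sub>K kron_pow A (n - i)"
proof -
  have "(i - 1) + Suc (n - i) = n"
    using assms by auto
  then show ?thesis
    using kron_pow_add[of A "i - 1" "Suc (n - i)"] by (simp add: kron_assoc)
qed

section \<open>Conjugating the wreath product\<close>

lemma mat_sum_mult_distrib:
  fixes P :: "'a :: semiring_0 mat"
  assumes "P \<in> carrier_mat d d" "\<And>i. i \<in> I \<Longrightarrow> f i \<in> carrier_mat d d"
  shows "mat_sum d f I * P = mat_sum d (\<lambda>i. f i * P) I"
proof (rule eq_matI)
  fix h k
  assume "h < dim_row (mat_sum d (\<lambda>i. f i * P) I)" "k < dim_col (mat_sum d (\<lambda>i. f i * P) I)"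
  then have hk: "h < d" "k < d"
    by (simp_all add: mat_sum_def)
  have "(mat_sum d f I * P) $$ (h, k) = (\<Sum>l<d. (\<Sum>i\<in>I. f i $$ (h, l)) * P $$ (l, k))"
    using assms(1) hk by (auto simp: mat_sum_def scalar_prod_def atLeast0LessThan)
  also have "\<dots> = (\<Sum>i\<in>I. \<Sum>l<d. f i $$ (h, l) * P $$ (l, k))"
    by (subst sum.swap) (simp add: sum_distrib_right)
  also have "\<dots> = (\<Sum>i\<in>I. (f i * P) $$ (h, k))"
  proof (rule sum.cong)
    fix i assume "i \<in> I"
    from assms(2)[OF this] show "(\<Sum>l<d. f i $$ (h, l) * P $$ (l, k)) = (f i * P) $$ (h, k)"
      using assms(1) hk by (auto simp: scalar_prod_def atLeast0LessThan)
  qed simp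
  finally show "(mat_sum d f I * P) $$ (h, k) = mat_sum d (\<lambda>i. f i * P) I $$ (h, k)"
    using hk by (simp add: mat_sum_def)
qed (use assms(1) in \<open>simp_all add: mat_sum_def\<close>)

lemma mult_mat_sum_distrib:
  fixes P :: "'a :: semiring_0 mat"
  assumes "P \<in> carrier_mat d d" "\<And>i. i \<in> I \<Longrightarrow> f i \<in> carrier_mat d d"
  shows "P * mat_sum d f I = mat_sum d (\<lambda>i. P * f i) I"
proof (rule eq_matI)
  fix h k
  assume "h < dim_row (mat_sum d (\<lambda>i. P * f i) I)" "k < dim_col (mat_sum d (\<lambda>i. P * f i) I)"
  then have hk: "h < d" "k < d"
    by (simp_all add: mat_sum_def)
  have "(P * mat_sum d f I) $$ (h, k) = (\<Sum>l<d. P $$ (h, l) * (\<Sum>i\<in>I. f i $$ (l, k)))"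
    using assms(1) hk by (auto simp: mat_sum_def scalar_prod_def atLeast0LessThan)
  also have "\<dots> = (\<Sum>i\<in>I. \<Sum>l<d. P $$ (h, l) * f i $$ (l, k))"
    by (subst sum.swap) (simp add: sum_distrib_left)
  also have "\<dots> = (\<Sum>i\<in>I. (P * f i) $$ (h, k))"
  proof (rule sum.cong)
    fix i assume "i \<in> I"
    from assms(2)[OF this] show "(\<Sum>l<d. P $$ (h, l) * f i $$ (l, k)) = (P * f i) $$ (h, k)"
      using assms(1) hk by (auto simp: scalar_prod_def atLeast0LessThan)
  qed simp
  finally show "(P * mat_sum d f I) $$ (h, k) = mat_sum d (\<lambda>i. P * f i) I $$ (h, k)"
    using hk by (simp add: mat_sum_def)
qed (use assms(1) in \<open>simp_all add: mat_sum_def\<close>)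

lemma diag_unit_carrier [simp]: "diag_unit n i \<in> carrier_mat n n"
  by (simp add: diag_unit_def)

text \<open>By the mixed product rule the claim can be checked in each tensor slot. Identity factors
  commute with everything, and the one remaining slot is the relation
  \<open>B * F = F * D\<close>.\<close>

lemma wreath_summand_intertwine:
  fixes B D F :: "complex mat"
  assumes i: "i \<in> {1..n}"
    and B: "B \<in> carrier_mat m m" and D: "D \<in> carrier_mat m m" and F: "F \<in> carrier_mat m m"
    and BF: "B * F = F * D"
  shows "(kron_pow (1\<^sub>m m) (i - 1) \<otimes>\<^sub>K B \<otimes>\<^sub>K kron_pow (1\<^sub>m m) (n - i) \<otimes>\<^sub>K diag_unit n i) *
      (kron_pow F n \<otimes>\<^sub>K 1\<^sub>m n) =
    (kron_pow F n \<otimes>\<^sub>K 1\<^sub>m n) *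
      (kron_pow (1\<^sub>m m) (i - 1) \<otimes>\<^sub>K D \<otimes>\<^sub>K kron_pow (1\<^sub>m m) (n - i) \<otimes>\<^sub>K diag_unit n i)"
proof -
  define a c where "a = i - 1" and "c = n - i"
  have carr: "kron_pow F k \<in> carrier_mat (m ^ k) (m ^ k)" for k
    by (rule kron_pow_carrier[OF F])
  have carr1: "kron_pow (1\<^sub>m m :: complex mat) k \<in> carrier_mat (m ^ k) (m ^ k)" for k
    by (rule kron_pow_carrier) simp
  \<comment> \<open>The mixed product rule for four left-nested factors, obtained by peeling off the
    last factor repeatedly.\<close>
  have mult: "(X\<^sub>1 \<otimes>\<^sub>K X\<^sub>2 \<otimes>\<^sub>K X\<^sub>3 \<otimes>\<^sub>K X\<^sub>4) * (Y\<^sub>1 \<otimes>\<^sub>K Y\<^sub>2 \<otimes>\<^sub>K Y\<^sub>3 \<otimes>\<^sub>K Y\<^sub>4) =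
      (X\<^sub>1 * Y\<^sub>1) \<otimes>\<^sub>K (X\<^sub>2 * Y\<^sub>2) \<otimes>\<^sub>K (X\<^sub>3 * Y\<^sub>3) \<otimes>\<^sub>K (X\<^sub>4 * Y\<^sub>4)"
    if X: "X\<^sub>1 \<in> carrier_mat (m ^ a) (m ^ a)" "X\<^sub>2 \<in> carrier_mat m m"
        "X\<^sub>3 \<in> carrier_mat (m ^ c) (m ^ c)" "X\<^sub>4 \<in> carrier_mat n n"
      and Y: "Y\<^sub>1 \<in> carrier_mat (m ^ a) (m ^ a)" "Y\<^sub>2 \<in> carrier_mat m m"
        "Y\<^sub>3 \<in> carrier_mat (m ^ c) (m ^ c)" "Y\<^sub>4 \<in> carrier_mat n n"
    for X\<^sub>1 X\<^sub>2 X\<^sub>3 X\<^sub>4 Y\<^sub>1 Y\<^sub>2 Y\<^sub>3 Y\<^sub>4 :: "complex mat"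
  proof -
    note X12 = kron_carrier[OF X(1,2)] and Y12 = kron_carrier[OF Y(1,2)]
    note X123 = kron_carrier[OF X12 X(3)] and Y123 = kron_carrier[OF Y12 Y(3)]
    show ?thesis
      by (simp only: kron_mult[OF X123 X(4) Y123 Y(4)] kron_mult[OF X12 X(3) Y12 Y(3)]
          kron_mult[OF X(1,2) Y(1,2)])
  qed
  have "(kron_pow (1\<^sub>m m) a \<otimes>\<^sub>K B \<otimes>\<^sub>K kron_pow (1\<^sub>m m) c \<otimes>\<^sub>K diag_unit n i) *
      (kron_pow F a \<otimes>\<^sub>K F \<otimes>\<^sub>K kron_pow F c \<otimes>\<^sub>K 1\<^sub>m n) =
      (kron_pow (1\<^sub>m m) a * kron_pow F a) \<otimes>\<^sub>K (B * F) \<otimes>\<^sub>K (kron_pow (1\<^sub>m m) c * kron_pow F c)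
        \<otimes>\<^sub>K (diag_unit n i * 1\<^sub>m n)"
    by (rule mult[OF carr1 B carr1 diag_unit_carrier carr F carr one_carrier_mat])
  also have "\<dots> = (kron_pow F a * kron_pow (1\<^sub>m m) a) \<otimes>\<^sub>K (F * D)
        \<otimes>\<^sub>K (kron_pow F c * kron_pow (1\<^sub>m m) c) \<otimes>\<^sub>K (1\<^sub>m n * diag_unit n i)"
    by (simp add: BF kron_pow_one left_mult_one_mat[OF carr] right_mult_one_mat[OF carr]
        left_mult_one_mat[OF diag_unit_carrier] right_mult_one_mat[OF diag_unit_carrier])
  also have "\<dots> = (kron_pow F a \<otimes>\<^sub>K F \<otimes>\<^sub>K kron_pow F c \<otimes>\<^sub>K 1\<^sub>m n) *
      (kron_pow (1\<^sub>m m) a \<otimes>\<^sub>K D \<otimes>\<^sub>K kron_pow (1\<^sub>m m) c \<otimes>\<^sub>K diag_unit n i)"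
    by (rule mult[OF carr F carr one_carrier_mat carr1 D carr1 diag_unit_carrier, symmetric])
  finally show ?thesis
    using kron_pow_split[OF i, of F] by (simp add: a_def c_def)
qed

lemma similar_mat_wreath:
  assumes A: "A \<in> carrier_mat n n" and B: "B \<in> carrier_mat m m" and D: "D \<in> carrier_mat m m"
    and F: "F \<in> carrier_mat m m" and G: "G \<in> carrier_mat m m"
    and FG: "F * G = 1\<^sub>m m" and GF: "G * F = 1\<^sub>m m" and BF: "B * F = F * D"
  shows "similar_mat (A \<wr> B) (A \<wr> D)"
proof -
  let ?P = "kron_pow F n \<otimes>\<^sub>K 1\<^sub>m n" and ?Q = "kron_pow G n \<otimes>\<^sub>K 1\<^sub>m n"
  let ?S = "\<lambda>X i. kron_pow (1\<^sub>m m) (i - 1) \<otimes>\<^sub>K X \<otimes>\<^sub>K kron_pow (1\<^sub>m m) (n - i) \<otimes>\<^sub>K diag_unit n i"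
  let ?d = "n * m ^ n"
  have carr: "kron_pow X n \<otimes>\<^sub>K Y \<in> carrier_mat ?d ?d"
    if "X \<in> carrier_mat m m" "Y \<in> carrier_mat n n" for X Y :: "complex mat"
    using kron_carrier[OF kron_pow_carrier[OF that(1)] that(2), of n] by (simp add: mult.commute)
  have P: "?P \<in> carrier_mat ?d ?d" and Q: "?Q \<in> carrier_mat ?d ?d"
    and IA: "kron_pow (1\<^sub>m m) n \<otimes>\<^sub>K A \<in> carrier_mat ?d ?d"
    using A F G by (auto intro: carr)
  have mult: "(kron_pow X n \<otimes>\<^sub>K Y) * (kron_pow X' n \<otimes>\<^sub>K Y') = kron_pow (X * X') n \<otimes>\<^sub>K (Y * Y')"
    if "X \<in> carrier_mat m m" "Y \<in> carrier_mat n n" "X' \<in> carrier_mat m m" "Y' \<in> carrier_mat n n"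
    for X Y X' Y' :: "complex mat"
    using kron_mult[OF kron_pow_carrier[OF that(1)] that(2) kron_pow_carrier[OF that(3)] that(4)]
      kron_pow_mult[OF that(1,3)] by simp
  have PQ: "?P * ?Q = 1\<^sub>m ?d" and QP: "?Q * ?P = 1\<^sub>m ?d"
    using F G by (simp_all add: mult FG GF kron_pow_one kron_one mult.commute)
  have eq: "A \<wr> X = kron_pow (1\<^sub>m m) n \<otimes>\<^sub>K A + mat_sum ?d (?S X) {1..n}"
    if "X \<in> carrier_mat m m" for X
    using A that by (simp add: wreath_def Let_def)
  have SC: "mat_sum ?d f I \<in> carrier_mat ?d ?d" for f :: "nat \<Rightarrow> complex mat" and I
    by (simp add: mat_sum_def)
  have "(A \<wr> B) * ?P = (kron_pow (1\<^sub>m m) n \<otimes>\<^sub>K A) * ?P + mat_sum ?d (?S B) {1..n} * ?P"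
    unfolding eq[OF B] by (rule add_mult_distrib_mat[OF IA SC P])
  \<comment> \<open>The two matrices act on different tensor factors: both products equal
    \<open>kron_pow F n \<otimes>\<^sub>K A\<close>.\<close>
  also have "(kron_pow (1\<^sub>m m) n \<otimes>\<^sub>K A) * ?P = ?P * (kron_pow (1\<^sub>m m) n \<otimes>\<^sub>K A)"
    using F A by (simp add: mult)
  also have "mat_sum ?d (?S B) {1..n} * ?P = mat_sum ?d (\<lambda>i. ?S B i * ?P) {1..n}"
    by (rule mat_sum_mult_distrib[OF P wreath_summand_carrier[OF B]])
  also have "\<dots> = mat_sum ?d (\<lambda>i. ?P * ?S D i) {1..n}"
    \<comment> \<open>The intertwining relation requires \<open>i \<in> {1..n}\<close>, so it is
      applied inside the entrywise sums, where this membership is available.\<close>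
    unfolding mat_sum_def
    by (intro arg_cong[where f = "mat ?d ?d"] ext)
       (auto intro!: sum.cong simp del: index_mult_mat
         simp: wreath_summand_intertwine[OF _ B D F BF, unfolded One_nat_def])
  also have "\<dots> = ?P * mat_sum ?d (?S D) {1..n}"
    by (rule mult_mat_sum_distrib[OF P wreath_summand_carrier[OF D], symmetric])
  also have "?P * (kron_pow (1\<^sub>m m) n \<otimes>\<^sub>K A) + \<dots> = ?P * (A \<wr> D)"
    unfolding eq[OF D] by (rule mult_add_distrib_mat[OF P IA SC, symmetric])
  finally have "(A \<wr> B) * ?P = ?P * (A \<wr> D)" .
  moreover have WB: "A \<wr> B \<in> carrier_mat ?d ?d" and WD: "A \<wr> D \<in> carrier_mat ?d ?d"
    using A B D by (auto intro: wreath_carrier)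
  ultimately have "A \<wr> B = ?P * (A \<wr> D) * ?Q"
    using assoc_mult_mat[OF WB P Q] PQ by simp
  then show ?thesis
    using WB WD P Q PQ QP by (intro similar_matI[of _ _ ?P ?Q ?d]) auto
qed

section \<open>Block diagonal matrices and the numbering of blocks by digits\<close>

text \<open>The characteristic matrix has the same block shape over the polynomial ring, and the
  determinant is multiplicative when the lower left block vanishes.\<close>

lemma char_poly_four_block_diag:
  fixes X Y :: "'a :: idom mat"
  assumes "X \<in> carrier_mat a a" "Y \<in> carrier_mat b b"
  shows "char_poly (four_block_mat X (0\<^sub>m a b) (0\<^sub>m b a) Y) = char_poly X * char_poly Y"
proof -
  have "char_poly_matrix (four_block_mat X (0\<^sub>m a b) (0\<^sub>m b a) Y) =
      four_block_mat (char_poly_matrix X) (0\<^sub>m a b) (0\<^sub>m b a) (char_poly_matrix Y)"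
    using assms by (intro eq_matI) (auto simp: char_poly_matrix_def)
  then show ?thesis
    using det_four_block_mat_lower_left_zero[of "char_poly_matrix X" a "0\<^sub>m a b" b "0\<^sub>m b a"] assms
    by (simp add: char_poly_def)
qed

text \<open>Induction on the number of blocks, splitting off the last one. Blocks are addressed by
  \<open>div\<close> and \<open>mod\<close> because Kronecker products are indexed in this
  way.\<close>

lemma char_poly_block_diag:
  fixes M :: "nat \<Rightarrow> 'a :: idom mat"
  assumes M: "\<And>r. r < N \<Longrightarrow> M r \<in> carrier_mat n n"
  shows "char_poly (mat (N * n) (N * n)
      (\<lambda>(i, j). if i div n = j div n then M (i div n) $$ (i mod n, j mod n) else 0)) =
    (\<Prod>r<N. char_poly (M r))"
  using assms
proof (induction N)
  case 0
  then show ?case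
    by (simp add: char_poly_def char_poly_matrix_def)
next
  case (Suc N)
  let ?T = "\<lambda>N. mat (N * n) (N * n)
      (\<lambda>(i, j). if i div n = j div n then M (i div n) $$ (i mod n, j mod n) else 0)"
  have MN: "M N \<in> carrier_mat n n"
    using Suc.prems by simp
  have last: "i div n = N" "i mod n = i - N * n" if "\<not> i < N * n" "i < n + N * n" for i
  proof -
    define s where "s = i - N * n"
    have "i = s + N * n" "s < n"
      using that by (auto simp: s_def)
    then show "i div n = N" "i mod n = i - N * n"
      by simp_all
  qed
  have first: "i div n < N" if "i < N * n" for i
    using that by (rule less_mult_imp_div_less)
  have "?T (Suc N) = four_block_mat (?T N) (0\<^sub>m (N * n) n) (0\<^sub>m n (N * n)) (M N)"
  proof (rule eq_matI, goal_cases)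
    case (1 i j)
    then have "i < n + N * n" "j < n + N * n"
      using MN by auto
    then show ?case
      using MN last[of i] last[of j] first[of i] first[of j]
      by (cases "i < N * n"; cases "j < N * n") simp_all
  qed (use MN in auto)
  then show ?case
    using char_poly_four_block_diag[of "?T N" "N * n" "M N" n] MN Suc by simp
qed

text \<open>The most significant digit has index 1, since the first tensor factor varies slowest.\<close>

definition digits_map :: "nat \<Rightarrow> nat \<Rightarrow> nat \<Rightarrow> nat \<Rightarrow> nat" where
  "digits_map n m r = (\<lambda>t\<in>{1..n}. r div m ^ (n - t) mod m)"

text \<open>A number below \<open>m ^ n\<close> is determined by its \<open>n\<close> digits in base
  \<open>m\<close>, which gives injectivity; surjectivity follows since both sets have
  \<open>m ^ n\<close> elements.\<close>

lemma bij_betw_digits_map: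
  assumes "m > 0"
  shows "bij_betw (digits_map n m) {..<m ^ n} ({1..n} \<rightarrow>\<^sub>E {..<m})"
proof -
  have digits_eq: "r = s" if "\<And>e. e < n \<Longrightarrow> r div m ^ e mod m = s div m ^ e mod m"
    "r < m ^ n" "s < m ^ n" for r s
    using that
  proof (induction n arbitrary: r s)
    case (Suc n)
    \<comment> \<open>Division by \<open>m\<close> drops the lowest digit: digit \<open>e\<close> of
      \<open>r div m\<close> is digit \<open>e + 1\<close> of \<open>r\<close>.\<close>
    have "r div m = s div m"
    proof (rule Suc.IH)
      fix e assume "e < n"
      then show "r div m div m ^ e mod m = s div m div m ^ e mod m"
        using Suc.prems(1)[of "Suc e"] by (simp add: div_mult2_eq)
    qed (use Suc.prems in \<open>auto simp: less_mult_imp_div_less mult.commute\<close>)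
    moreover have "r mod m = s mod m"
      using Suc.prems(1)[of 0] by simp
    ultimately show ?case
      by (metis div_mult_mod_eq)
  qed simp
  have "inj_on (digits_map n m) {..<m ^ n}"
  proof (rule inj_onI)
    fix r s
    assume rs: "r \<in> {..<m ^ n}" "s \<in> {..<m ^ n}" and eq: "digits_map n m r = digits_map n m s"
    show "r = s"
    proof (rule digits_eq)
      \<comment> \<open>The digit of weight \<open>m ^ e\<close> is stored at index
        \<open>n - e\<close>.\<close>
      fix e assume "e < n"
      then show "r div m ^ e mod m = s div m ^ e mod m"
        using fun_cong[OF eq, of "n - e"] by (simp add: digits_map_def Suc_le_eq)
    qed (use rs in auto)
  qed
  moreover have "digits_map n m ` {..<m ^ n} \<subseteq> {1..n} \<rightarrow>\<^sub>E {..<m}"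
    using assms by (auto simp: digits_map_def)
  moreover from calculation have "digits_map n m ` {..<m ^ n} = {1..n} \<rightarrow>\<^sub>E {..<m}"
    by (intro card_subset_eq) (auto simp: card_image card_PiE finite_PiE)
  ultimately show ?thesis
    by (simp add: bij_betw_def)
qed

text \<open>All summands but the one with \<open>A\<close> become diagonal, so rows
  \<open>r * n + s\<close> with a common \<open>r\<close> form a block. As \<open>r\<close> runs
  below \<open>m ^ n\<close>, its digits run through all tuples \<open>\<iota>\<close>. The
  \<open>Suc s\<close> matches rows counted from 0 with tensor factors counted from 1.\<close>

lemma char_poly_wreath_mat_diag:
  assumes A: "A \<in> carrier_mat n n" and m: "m > 0"
  shows "char_poly (A \<wr> mat_diag m d) =
    (\<Prod>\<iota>\<in>{1..n} \<rightarrow>\<^sub>E {..<m}. char_poly (A + mat_diag n (\<lambda>s. d (\<iota> (Suc s)))))"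
proof -
  let ?M = "\<lambda>\<iota>. A + mat_diag n (\<lambda>s. d (\<iota> (Suc s)))"
  \<comment> \<open>The factors to the right have total order \<open>m ^ (n - i)\<close>, so the
    middle factor sees the digit of \<open>r\<close> of that weight, which is digit number
    \<open>i\<close>.\<close>
  have *: "kron_pow (1\<^sub>m m) (i - 1) \<otimes>\<^sub>K mat_diag m d \<otimes>\<^sub>K kron_pow (1\<^sub>m m) (n - i) =
      mat_diag (m ^ n) (\<lambda>r. d (digits_map n m r i))" if "i \<in> {1..n}" for i
  proof -
    have "m ^ (i - 1) * m * m ^ (n - i) = m ^ (i - 1 + 1 + (n - i))"
      by (simp add: power_add)
    also have "i - 1 + 1 + (n - i) = n"
      using that by simp
    finally show ?thesis
      using that unfolding kron_pow_one
      unfolding mat_diag_one[symmetric] kron_mat_diag by (simp add: digits_map_def)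
  qed
  have "A \<wr> mat_diag m d = mat (m ^ n * n) (m ^ n * n)
      (\<lambda>(i, j). if i div n = j div n then ?M (digits_map n m (i div n)) $$ (i mod n, j mod n) else 0)"
    (is "_ = ?R")
  proof (rule eq_matI)
    fix i j
    assume "i < dim_row ?R" "j < dim_col ?R"
    then have ij: "i < m ^ n * n" "j < m ^ n * n"
      by auto
    note bounds = div_mod_less_of_less_mult[OF ij(1)] div_mod_less_of_less_mult[OF ij(2)]
    have "(A \<wr> mat_diag m d) $$ (i, j) = (1\<^sub>m (m ^ n) \<otimes>\<^sub>K A) $$ (i, j) +
        (\<Sum>t\<in>{1..n}. (kron_pow (1\<^sub>m m) (t - 1) \<otimes>\<^sub>K mat_diag m d \<otimes>\<^sub>K kron_pow (1\<^sub>m m) (n - t)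
          \<otimes>\<^sub>K diag_unit n t) $$ (i, j))"
      using A ij by (simp add: wreath_def Let_def mat_sum_def kron_pow_one mat_diag_def mult.commute)
    \<comment> \<open>The factor \<open>diag_unit n t\<close> vanishes unless both remainders equal
      \<open>t - 1\<close>, so a single \<open>t\<close> survives.\<close>
    also have "(\<Sum>t\<in>{1..n}. (kron_pow (1\<^sub>m m) (t - 1) \<otimes>\<^sub>K mat_diag m d \<otimes>\<^sub>K kron_pow (1\<^sub>m m) (n - t)
          \<otimes>\<^sub>K diag_unit n t) $$ (i, j)) =
        (\<Sum>t\<in>{1..n}. if t = Suc (i mod n) then
          (if i div n = j div n \<and> i mod n = j mod n then d (digits_map n m (i div n) t) else 0) else 0)"
      using ij bounds
      by (intro sum.cong refl, subst *) (auto simp: index_kron mat_diag_def diag_unit_def)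
    also have "\<dots> = (if i div n = j div n \<and> i mod n = j mod n
        then d (digits_map n m (i div n) (Suc (i mod n))) else 0)"
      using bounds by (subst sum.delta) auto
    also have "(1\<^sub>m (m ^ n) \<otimes>\<^sub>K A) $$ (i, j) =
        (if i div n = j div n then A $$ (i mod n, j mod n) else 0)"
      using A ij bounds by (simp add: index_kron)
    finally show "(A \<wr> mat_diag m d) $$ (i, j) = ?R $$ (i, j)"
      using A ij bounds by (auto simp: mat_diag_def)
  qed (use wreath_carrier[OF A, of "mat_diag m d" m] in \<open>auto simp: mult.commute\<close>)
  then have "char_poly (A \<wr> mat_diag m d) = (\<Prod>r<m ^ n. char_poly (?M (digits_map n m r)))"
    using A char_poly_block_diag[of "m ^ n" "\<lambda>r. ?M (digits_map n m r)" n] by simp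
  also have "\<dots> = (\<Prod>\<iota>\<in>{1..n} \<rightarrow>\<^sub>E {..<m}. char_poly (?M \<iota>))"
    by (rule prod.reindex_bij_betw[OF bij_betw_digits_map[OF m]])
  finally show ?thesis .
qed

section \<open>Fourier diagonalisation of circulant matrices\<close>

lemma sum_powers_root_of_unity:
  fixes z :: "'a :: field"
  assumes "z ^ m = 1"
  shows "(\<Sum>j<m. z ^ j) = (if z = 1 then of_nat m else 0)"
  using assms by (simp add: geometric_sum)

text \<open>The discrete Fourier matrix without normalisation; the factor \<open>1 / m\<close> is
  put entirely into the inverse.\<close>

definition fourier_mat :: "nat \<Rightarrow> 'a :: semiring_1 \<Rightarrow> 'a mat" where
  "fourier_mat m w = mat m m (\<lambda>(h, k). w ^ (h * k))"

lemma fourier_mat_carrier [simp]: "fourier_mat m w \<in> carrier_mat m m"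
  by (simp add: fourier_mat_def)

text \<open>Orthogonality of the characters of the cyclic group of order \<open>m\<close>: each
  entry is an average of powers of an \<open>m\<close>-th root of unity. Injectivity of the powers
  expresses that \<open>w\<close> is a primitive root.\<close>

lemma fourier_mat_inverse:
  fixes w :: "'a :: field_char_0"
  assumes "m > 0" "w ^ m = 1" and inj: "inj_on (\<lambda>k. w ^ k) {..<m}"
  shows "fourier_mat m w * (inverse (of_nat m) \<cdot>\<^sub>m fourier_mat m (inverse w)) = 1\<^sub>m m"
proof (rule eq_matI)
  fix h k
  assume "h < dim_row (1\<^sub>m m :: 'a mat)" "k < dim_col (1\<^sub>m m :: 'a mat)"
  then have hk: "h < m" "k < m"
    by auto
  have "w \<noteq> 0"
    using assms(1,2) by (auto simp: power_0_left)
  \<comment> \<open>This is \<open>w\<close> to the power \<open>h - k\<close>, written without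
    negative exponents.\<close>
  define z where "z = w ^ h * inverse w ^ k"
  have "z ^ m = (w ^ m) ^ h * inverse (w ^ m) ^ k"
    by (simp add: z_def power_mult_distrib power_inverse power_mult[symmetric] mult.commute)
  then have "z ^ m = 1"
    using assms(2) by simp
  moreover have "z = 1 \<longleftrightarrow> h = k"
    using hk \<open>w \<noteq> 0\<close> inj_onD[OF inj, of h k] by (auto simp: z_def power_inverse field_simps)
  moreover have "(fourier_mat m w * (inverse (of_nat m) \<cdot>\<^sub>m fourier_mat m (inverse w))) $$ (h, k) =
      inverse (of_nat m) * (\<Sum>j<m. z ^ j)"
    using hk by (simp add: fourier_mat_def scalar_prod_def z_def atLeast0LessThan sum_distrib_left
        power_mult_distrib power_mult[symmetric] mult_ac)
  ultimately show "(fourier_mat m w * (inverse (of_nat m) \<cdot>\<^sub>m fourier_mat m (inverse w))) $$ (h, k) =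
      1\<^sub>m m $$ (h, k)"
    using hk assms(1) by (simp add: sum_powers_root_of_unity)
qed (simp_all add: fourier_mat_def)

text \<open>Column \<open>k\<close> of the Fourier matrix is an eigenvector: a cyclic shift of the
  summation index by \<open>h\<close> pulls out the factor \<open>w ^ (h * k)\<close> and leaves a
  sum independent of \<open>h\<close>.\<close>

lemma circulant_mat_mult_fourier_mat:
  fixes w :: "'a :: comm_ring_1"
  assumes "m > 0" "w ^ m = 1"
  shows "circulant_mat m b * fourier_mat m w =
    fourier_mat m w * mat_diag m (\<lambda>k. \<Sum>i<m. b i * w ^ (i * k))"
proof (rule eq_matI)
  fix h k
  assume "h < dim_row (fourier_mat m w * mat_diag m (\<lambda>k. \<Sum>i<m. b i * w ^ (i * k)))"
    "k < dim_col (fourier_mat m w * mat_diag m (\<lambda>k. \<Sum>i<m. b i * w ^ (i * k)))"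
  then have hk: "h < m" "k < m"
    by (auto simp: fourier_mat_def mat_diag_def)
  have pow_mod: "w ^ (x mod m) = w ^ x" for x
  proof -
    have "w ^ x = (w ^ m) ^ (x div m) * w ^ (x mod m)"
      by (simp flip: power_mult power_add)
    then show ?thesis
      by (simp add: assms(2))
  qed
  have "(circulant_mat m b * fourier_mat m w) $$ (h, k) =
      (\<Sum>j<m. b (nat ((int j - int h) mod int m)) * w ^ (j * k))"
    using hk by (simp add: circulant_mat_def fourier_mat_def scalar_prod_def atLeast0LessThan)
  \<comment> \<open>Substitution of \<open>j = (i + h) mod m\<close>, a permutation of the residues.
    The inverse passes through the integers since \<open>j - h\<close> may be negative.\<close>
  also have "\<dots> = (\<Sum>i<m. b i * w ^ ((i + h) mod m * k))"
  proof (rule sum.reindex_bij_witness[of _ "\<lambda>i. (i + h) mod m" "\<lambda>j. nat ((int j - int h) mod int m)"])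
    fix j assume "j \<in> {..<m}"
    then have "int ((nat ((int j - int h) mod int m) + h) mod m) = int j"
      by (simp add: zmod_int mod_simps)
    then show eq: "(nat ((int j - int h) mod int m) + h) mod m = j"
      by linarith
    show "nat ((int j - int h) mod int m) \<in> {..<m}"
      using assms(1) by (simp add: nat_less_iff)
    show "b (nat ((int j - int h) mod int m)) * w ^ ((nat ((int j - int h) mod int m) + h) mod m * k) =
        b (nat ((int j - int h) mod int m)) * w ^ (j * k)"
      by (simp only: eq)
  next
    fix i assume "i \<in> {..<m}"
    then show "nat ((int ((i + h) mod m) - int h) mod int m) = i"
      by (simp add: zmod_int mod_simps)
    show "(i + h) mod m \<in> {..<m}"
      using assms(1) by simp
  qed
  also have "\<dots> = (\<Sum>i<m. b i * w ^ ((i + h) * k))"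
    \<comment> \<open>Writing the power as a \<open>k\<close>-th power of
      \<open>w ^ ((i + h) mod m)\<close> exposes an exponent that \<open>pow_mod\<close> can
      reduce.\<close>
    by (simp only: power_mult pow_mod)
  also have "\<dots> = (fourier_mat m w * mat_diag m (\<lambda>k. \<Sum>i<m. b i * w ^ (i * k))) $$ (h, k)"
    using hk by (subst mat_diag_mult_right[of _ m])
      (simp_all add: fourier_mat_def sum_distrib_left algebra_simps power_add)
  finally show "(circulant_mat m b * fourier_mat m w) $$ (h, k) =
      (fourier_mat m w * mat_diag m (\<lambda>k. \<Sum>i<m. b i * w ^ (i * k))) $$ (h, k)" .
qed (simp_all add: circulant_mat_def fourier_mat_def mat_diag_def)

text \<open>The powers of \<rho> are the points at angles \<open>2 * pi * k / m\<close>, the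
  standard enumeration of the \<open>m\<close>-th roots of unity without repetition. So \<rho> is
  primitive.\<close>

lemma exp_root_of_unity:
  assumes "m > 0" "\<rho> = exp (2 * of_real pi * \<i> / of_nat m)"
  shows "\<rho> ^ m = 1" "inj_on (\<lambda>k. \<rho> ^ k) {..<m}"
proof -
  have \<rho>: "\<rho> = cis (2 * pi / real m)"
    by (simp add: assms(2) cis_conv_exp mult_ac)
  have pow: "\<rho> ^ k = cis (2 * pi * real k / real m)" for k
    by (simp add: \<rho> DeMoivre mult_ac)
  show "\<rho> ^ m = 1"
    using assms(1) by (simp add: pow)
  show "inj_on (\<lambda>k. \<rho> ^ k) {..<m}"
    using bij_betw_roots_unity[OF assms(1)] by (simp add: pow bij_betw_def)
qed

section \<open>From similarity to multisets of eigenvalues\<close>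

theorem theorem5p1:
  fixes n m :: nat and A B :: "complex mat" and b :: "nat \<Rightarrow> complex" and \<rho> :: complex
  assumes "n > 0" and "m > 0"
    and "A \<in> carrier_mat n n"
    and "B = circulant_mat m b"
    and "\<rho> = exp (2 * of_real pi * \<i> / of_nat m)"
  shows "spectrum_mset (A \<wr> B) =
    (\<Sum>\<iota> \<in> {1..n} \<rightarrow>\<^sub>E {0..m - 1}.
       spectrum_mset
         (A + mat_sum n (\<lambda>t. mat_sum n (\<lambda>i. (b i * \<rho> ^ (i * \<iota> t)) \<cdot>\<^sub>m diag_unit n t) {0..m - 1}) {1..n}))"
proof -
  define d where "d k = (\<Sum>i<m. b i * \<rho> ^ (i * k))" for k
  \<comment> \<open>Positivity of \<open>m\<close> matters: with truncated subtraction,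
    \<open>{0..m - 1}\<close> would be \<open>{0}\<close> for \<open>m = 0\<close>.\<close>
  have range: "{0..m - 1} = {..<m}"
    using assms(2) by auto
  note root = exp_root_of_unity[OF assms(2,5)]
  let ?F = "fourier_mat m \<rho>" and ?G = "inverse (of_nat m) \<cdot>\<^sub>m fourier_mat m (inverse \<rho>)"
  have FG: "?F * ?G = 1\<^sub>m m"
    by (rule fourier_mat_inverse[OF assms(2) root])
  moreover have "?G * ?F = 1\<^sub>m m"
    \<comment> \<open>For square matrices over a field a one-sided inverse is two-sided.\<close>
    by (rule mat_mult_left_right_inverse[OF _ _ FG]) auto
  moreover have "B * ?F = ?F * mat_diag m d"
    unfolding assms(4) d_def by (rule circulant_mat_mult_fourier_mat[OF assms(2) root(1)])
  moreover have "B \<in> carrier_mat m m"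
    by (simp add: assms(4) circulant_mat_def)
  ultimately have "similar_mat (A \<wr> B) (A \<wr> mat_diag m d)"
    using assms(3) by (intro similar_mat_wreath[where F = ?F and G = ?G]) auto
  then have "char_poly (A \<wr> B) =
      (\<Prod>\<iota>\<in>{1..n} \<rightarrow>\<^sub>E {..<m}. char_poly (A + mat_diag n (\<lambda>s. d (\<iota> (Suc s)))))"
    using char_poly_similar char_poly_wreath_mat_diag[OF assms(3,2)] by metis
  \<comment> \<open>Root multisets of a product add up when all factors are nonzero.\<close>
  moreover have "char_poly (A + mat_diag n f) \<noteq> 0" for f
    using degree_monic_char_poly[of "A + mat_diag n f" n] assms(3) by auto
  ultimately have "spectrum_mset (A \<wr> B) =
      (\<Sum>\<iota>\<in>{1..n} \<rightarrow>\<^sub>E {..<m}. spectrum_mset (A + mat_diag n (\<lambda>s. d (\<iota> (Suc s)))))"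
    by (simp add: spectrum_mset_def proots_prod)
  \<comment> \<open>In row \<open>h\<close> only the term \<open>t = Suc h\<close> contributes,
    which turns the double sum of the statement into a diagonal matrix.\<close>
  moreover have "mat_diag n (\<lambda>s. d (\<iota> (Suc s))) =
      mat_sum n (\<lambda>t. mat_sum n (\<lambda>i. (b i * \<rho> ^ (i * \<iota> t)) \<cdot>\<^sub>m diag_unit n t) {..<m}) {1..n}" for \<iota>
  proof (rule eq_matI, goal_cases)
    case (1 h k)
    then have hk: "h < n" "k < n"
      by (simp_all add: mat_sum_def)
    have "(\<Sum>t\<in>{1..n}. \<Sum>i<m. b i * \<rho> ^ (i * \<iota> t) * (if Suc h = t \<and> Suc k = t then 1 else 0)) =
        (\<Sum>t\<in>{1..n}. if t = Suc h then (if h = k then d (\<iota> t) else 0) else 0)"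
      by (intro sum.cong) (auto simp: d_def)
    also have "\<dots> = (if h = k then d (\<iota> (Suc h)) else 0)"
      using hk by (subst sum.delta) auto
    finally show ?case
      using hk by (simp add: mat_sum_def diag_unit_def mat_diag_def)
  qed (simp_all add: mat_sum_def mat_diag_def)
  ultimately show ?thesis
    unfolding range by simp
qed

end
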